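(* Let $X$ be a connected quasi-median graph (simplicial, countable). Then for any root $o\in X$ the graph compactification $\overline{(X,o)}$ is visual.
   Context: A graph $X$ (no loops or multiple edges, graph metric $d$) is quasi-median if: (1) triangle condition: for all vertices $o,x,y$ with $x,y$ adjacent and $d(o,x)=d(o,y)$, there is a common neighbor $z$ of $x,y$ with $d(o,z)=d(o,x)-1$; (2) quadrangle condition: for all vertices $o,x,y,z$ with $x,y$ distinct and non-adjacent, $d(x,z)=d(y,z)=1$ and $d(o,x)=d(o,y)=d(o,z)-1$, there is a common neighbor $w$ of $x,y$ with $d(o,w)=d(o,z)-2$; (3) no two triangles share exactly one edge (no induced $K_4^-$), and no two 4-cycles share exactly two adjacent edges (no induced $K_{3,2}$). Graph compactification: for vertices $x,y$ write $x\le_oy$ if $x$ lies on some geodesic from $o$ to $y$. For a sequence of vertices $\mathbf x=(x_n)$ write $x\le_o\mathbf x$ if $x\le_ox_n$ for all large $n$, and $x\nleq_o\mathbf x$ if $x\nleq_ox_n$ for all large $n$. $\mathbf x$ $o$-converges if for every vertex $x$ either $x\le_o\mathbf x$ or $x\nleq_o\mathbf x$. Two $o$-converging sequences $\mathbf x,\mathbf y$ are equivalent if for every vertex $x$: $x\le_o\mathbf x\Leftrightarrow x\le_o\mathbf y$. $\overline{(X,o)}$ is the set of equivalence classes of $o$-converging sequences. It is visual if every class is represented by the vertex set of a (possibly finite) geodesic path (listed in order; a finite path is regarded as eventually constant at its endpoint). *)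

theory Defs
  imports Main "HOL-Library.Countable_Set" "HOL-Library.Extended_Nat"
begin

text \<open>A graph is given by its vertex set \<open>V\<close> and its adjacency relation \<open>E\<close>.\<close>

definition simple_graph :: "'a set \<Rightarrow> ('a \<Rightarrow> 'a \<Rightarrow> bool) \<Rightarrow> bool" where
  "simple_graph V E \<longleftrightarrow>
     (\<forall>x y. E x y \<longrightarrow> x \<in> V \<and> y \<in> V) \<and>
     (\<forall>x y. E x y \<longrightarrow> E y x) \<and>
     (\<forall>x. \<not> E x x)"

definition connected_graph :: "'a set \<Rightarrow> ('a \<Rightarrow> 'a \<Rightarrow> bool) \<Rightarrow> bool" where
  "connected_graph V E \<longleftrightarrow> (\<forall>x\<in>V. \<forall>y\<in>V. E\<^sup>*\<^sup>* x y)"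

text \<open>\<open>(E ^^ n) x y\<close> says that there is an edge walk of length \<open>n\<close> from \<open>x\<close> to \<open>y\<close>.
  The value is only meaningful if \<open>x\<close> and \<open>y\<close> lie in the same component.\<close>

definition gdist :: "('a \<Rightarrow> 'a \<Rightarrow> bool) \<Rightarrow> 'a \<Rightarrow> 'a \<Rightarrow> nat" where
  "gdist E x y = (LEAST n. (E ^^ n) x y)"

subsection \<open>Quasi-median graphs\<close>

text \<open>The identities between distances are stated additively, because subtraction on
  \<^typ>\<open>nat\<close> truncates.\<close>

definition triangle_condition :: "'a set \<Rightarrow> ('a \<Rightarrow> 'a \<Rightarrow> bool) \<Rightarrow> bool" where
  "triangle_condition V E \<longleftrightarrow>
     (\<forall>r\<in>V. \<forall>x\<in>V. \<forall>y\<in>V. E x y \<and> gdist E r x = gdist E r y \<longrightarrow>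
        (\<exists>z\<in>V. E x z \<and> E y z \<and> gdist E r z + 1 = gdist E r x))"

definition quadrangle_condition :: "'a set \<Rightarrow> ('a \<Rightarrow> 'a \<Rightarrow> bool) \<Rightarrow> bool" where
  "quadrangle_condition V E \<longleftrightarrow>
     (\<forall>r\<in>V. \<forall>x\<in>V. \<forall>y\<in>V. \<forall>z\<in>V.
        x \<noteq> y \<and> \<not> E x y \<and> gdist E x z = 1 \<and> gdist E y z = 1 \<and>
        gdist E r x = gdist E r y \<and> gdist E r x + 1 = gdist E r z \<longrightarrow>
        (\<exists>w\<in>V. E x w \<and> E y w \<and> gdist E r w + 2 = gdist E r z))"

definition has_induced_copy ::
    "'a set \<Rightarrow> ('a \<Rightarrow> 'a \<Rightarrow> bool) \<Rightarrow> 'b set \<Rightarrow> ('b \<Rightarrow> 'b \<Rightarrow> bool) \<Rightarrow> bool" where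
  "has_induced_copy V E W F \<longleftrightarrow>
     (\<exists>f. inj_on f W \<and> f ` W \<subseteq> V \<and> (\<forall>u\<in>W. \<forall>v\<in>W. E (f u) (f v) \<longleftrightarrow> F u v))"

text \<open>\<open>K\<^sub>4\<close> with the edge between 2 and 3 removed, on the vertices \<open>{0, 1, 2, 3}\<close>.\<close>

definition K4_minus_adj :: "nat \<Rightarrow> nat \<Rightarrow> bool" where
  "K4_minus_adj u v \<longleftrightarrow> u \<noteq> v \<and> {u, v} \<noteq> {2, 3}"

text \<open>The complete bipartite graph with parts \<open>{0, 1, 2}\<close> and \<open>{3, 4}\<close>.\<close>

definition K32_adj :: "nat \<Rightarrow> nat \<Rightarrow> bool" where
  "K32_adj u v \<longleftrightarrow> (u \<in> {0, 1, 2} \<and> v \<in> {3, 4}) \<or> (u \<in> {3, 4} \<and> v \<in> {0, 1, 2})"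

definition quasi_median :: "'a set \<Rightarrow> ('a \<Rightarrow> 'a \<Rightarrow> bool) \<Rightarrow> bool" where
  "quasi_median V E \<longleftrightarrow>
     triangle_condition V E \<and>
     quadrangle_condition V E \<and>
     \<not> has_induced_copy V E {0, 1, 2, 3} K4_minus_adj \<and>
     \<not> has_induced_copy V E {0, 1, 2, 3, 4} K32_adj"

subsection \<open>Geodesic paths\<close>

text \<open>\<open>geodesic_path V E N p\<close>: the vertices \<open>p 0, p 1, \<dots>\<close> with indices at most \<open>N\<close> form a
  geodesic path; it is a finite path with \<open>N\<close> edges if \<open>N\<close> is finite, and an infinite one if
  \<open>N = \<infinity>\<close>. Values of \<open>p\<close> beyond \<open>N\<close> are irrelevant.\<close>

definition geodesic_path :: "'a set \<Rightarrow> ('a \<Rightarrow> 'a \<Rightarrow> bool) \<Rightarrow> enat \<Rightarrow> (nat \<Rightarrow> 'a) \<Rightarrow> bool" where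
  "geodesic_path V E N p \<longleftrightarrow>
     (\<forall>i. enat i \<le> N \<longrightarrow> p i \<in> V) \<and>
     (\<forall>i. enat (Suc i) \<le> N \<longrightarrow> E (p i) (p (Suc i))) \<and>
     (\<forall>i j. i \<le> j \<and> enat j \<le> N \<longrightarrow> gdist E (p i) (p j) = j - i)"

text \<open>The vertices of a path listed in order, a finite path being continued by its endpoint.\<close>

definition path_sequence :: "enat \<Rightarrow> (nat \<Rightarrow> 'a) \<Rightarrow> nat \<Rightarrow> 'a" where
  "path_sequence N p n = (case N of enat m \<Rightarrow> p (min n m) | \<infinity> \<Rightarrow> p n)"

subsection \<open>The graph compactification\<close>

text \<open>The root is called \<open>r\<close> throughout.\<close>

definition root_le :: "'a set \<Rightarrow> ('a \<Rightarrow> 'a \<Rightarrow> bool) \<Rightarrow> 'a \<Rightarrow> 'a \<Rightarrow> 'a \<Rightarrow> bool" where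
  "root_le V E r x y \<longleftrightarrow>
     (\<exists>m p. geodesic_path V E (enat m) p \<and> p 0 = r \<and> p m = y \<and> (\<exists>i\<le>m. p i = x))"

definition root_le_seq :: "'a set \<Rightarrow> ('a \<Rightarrow> 'a \<Rightarrow> bool) \<Rightarrow> 'a \<Rightarrow> 'a \<Rightarrow> (nat \<Rightarrow> 'a) \<Rightarrow> bool" where
  "root_le_seq V E r x s \<longleftrightarrow> (\<forall>\<^sub>F n in sequentially. root_le V E r x (s n))"

text \<open>This is stronger than the negation of \<^const>\<open>root_le_seq\<close>.\<close>

definition root_nle_seq :: "'a set \<Rightarrow> ('a \<Rightarrow> 'a \<Rightarrow> bool) \<Rightarrow> 'a \<Rightarrow> 'a \<Rightarrow> (nat \<Rightarrow> 'a) \<Rightarrow> bool" where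
  "root_nle_seq V E r x s \<longleftrightarrow> (\<forall>\<^sub>F n in sequentially. \<not> root_le V E r x (s n))"

definition root_converging :: "'a set \<Rightarrow> ('a \<Rightarrow> 'a \<Rightarrow> bool) \<Rightarrow> 'a \<Rightarrow> (nat \<Rightarrow> 'a) set" where
  "root_converging V E r =
     {s. range s \<subseteq> V \<and> (\<forall>x\<in>V. root_le_seq V E r x s \<or> root_nle_seq V E r x s)}"

definition root_equiv ::
    "'a set \<Rightarrow> ('a \<Rightarrow> 'a \<Rightarrow> bool) \<Rightarrow> 'a \<Rightarrow> ((nat \<Rightarrow> 'a) \<times> (nat \<Rightarrow> 'a)) set" where
  "root_equiv V E r =
     {(s, t). s \<in> root_converging V E r \<and> t \<in> root_converging V E r \<and>
        (\<forall>x\<in>V. root_le_seq V E r x s \<longleftrightarrow> root_le_seq V E r x t)}"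

lemma equiv_root_equiv: "equiv (root_converging V E r) (root_equiv V E r)"
  by (rule equivI) (auto simp: root_equiv_def refl_on_def sym_def trans_def)

definition graph_compactification ::
    "'a set \<Rightarrow> ('a \<Rightarrow> 'a \<Rightarrow> bool) \<Rightarrow> 'a \<Rightarrow> (nat \<Rightarrow> 'a) set set" where
  "graph_compactification V E r = root_converging V E r // root_equiv V E r"

definition visual :: "'a set \<Rightarrow> ('a \<Rightarrow> 'a \<Rightarrow> bool) \<Rightarrow> 'a \<Rightarrow> bool" where
  "visual V E r \<longleftrightarrow>
     (\<forall>c \<in> graph_compactification V E r.
        \<exists>N p. geodesic_path V E N p \<and> path_sequence N p \<in> c)"

end

theory Submission imports Defs begin

text \<open>
  Fix the root \<open>r\<close> and order the vertices by \<open>x \<preceq> y\<close> iff \<open>x\<close> lies on a geodesic from \<open>r\<close> to \<open>y\<close>;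
  the distance from \<open>r\<close> is a rank function for this order. A converging sequence \<open>s\<close> is described,
  up to equivalence, by the down-set \<open>A\<close> of the vertices that are eventually below \<open>s\<close>. A countable
  down-set is the down-closure of a geodesic issuing from \<open>r\<close> as soon as it is nonempty and directed,
  for then it contains a cofinal increasing chain, and the members of the chain can be joined
  successively by geodesics (\<open>directed_imp_ascending_ray\<close>).

  What has to be shown is therefore that \<open>A\<close> is directed. Any two elements \<open>x\<close>, \<open>y\<close> of \<open>A\<close> have the
  common upper bounds \<open>s n\<close> for all large \<open>n\<close>, but these could dominate different minimal upper
  bounds of \<open>x\<close> and \<open>y\<close> for different \<open>n\<close>. In a quasi-median graph they do not: vertices with a
  common upper bound have a least one. This is local at first (\<open>local_join\<close>): if \<open>a\<close> and \<open>b\<close> cover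
  \<open>x\<close> and lie below \<open>u\<close>, then the triangle and quadrangle conditions with base point \<open>u\<close> yield a
  common cover of \<open>a\<close> and \<open>b\<close> below \<open>u\<close>, and the forbidden induced subgraphs make this common cover
  independent of \<open>u\<close>. As in Newman's lemma, an induction on the distance to an upper bound passes
  from covers to arbitrary pairs (\<open>interpolation\<close>).
\<close>

section \<open>The graph metric\<close>

locale connected_simple_graph =
  fixes V :: "'a set" and E :: "'a \<Rightarrow> 'a \<Rightarrow> bool"
  assumes simple: "simple_graph V E"
    and connected: "connected_graph V E"
begin

abbreviation d :: "'a \<Rightarrow> 'a \<Rightarrow> nat" where
  "d \<equiv> gdist E"

lemma edge_in_V: "E x y \<Longrightarrow> x \<in> V" "E x y \<Longrightarrow> y \<in> V"
  and edge_sym: "E x y \<Longrightarrow> E y x"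
  and edge_irrefl: "\<not> E x x"
  using simple unfolding simple_graph_def by blast+

lemma gdist_le_walk: "(E ^^ n) x y \<Longrightarrow> d x y \<le> n"
  unfolding gdist_def by (rule Least_le)

lemma walk_gdist:
  assumes "x \<in> V" "y \<in> V"
  shows "(E ^^ d x y) x y"
proof -
  have "E\<^sup>*\<^sup>* x y" using connected assms unfolding connected_graph_def by blast
  then obtain n where "(E ^^ n) x y" using rtranclp_imp_relpowp by metis
  then show ?thesis unfolding gdist_def by (rule LeastI)
qed

lemma gdist_self [simp]: "d x x = 0"
  using gdist_le_walk[of 0 x x] by simp

lemma gdist_eq_0: "x \<in> V \<Longrightarrow> y \<in> V \<Longrightarrow> d x y = 0 \<Longrightarrow> x = y"
  using walk_gdist[of x y] by simp

lemma gdist_triangle: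
  assumes "x \<in> V" "y \<in> V" "z \<in> V"
  shows "d x z \<le> d x y + d y z"
proof -
  have "(E ^^ (d x y + d y z)) x z"
    using walk_gdist[OF assms(1,2)] walk_gdist[OF assms(2,3)] by (auto simp: relpowp_add)
  then show ?thesis by (rule gdist_le_walk)
qed

lemma walk_sym: "(E ^^ n) x y \<Longrightarrow> (E ^^ n) y x"
proof (induction n arbitrary: y)
  case (Suc n)
  then obtain z where "(E ^^ n) x z" "E z y" by auto
  then show ?case using Suc.IH edge_sym relpowp_Suc_I2 by metis
qed simp

lemma gdist_sym:
  assumes "x \<in> V" "y \<in> V"
  shows "d x y = d y x"
  using assms walk_gdist walk_sym gdist_le_walk by (metis le_antisym)

lemma gdist_edge:
  assumes "E x y"
  shows "d x y = 1"
proof -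
  have "d x y \<le> 1" using assms by (intro gdist_le_walk) auto
  moreover have "d x y \<noteq> 0" using assms gdist_eq_0 edge_in_V edge_irrefl by metis
  ultimately show ?thesis by simp
qed

lemma step_towards:
  assumes "x \<in> V" "y \<in> V" "x \<noteq> y"
  obtains a where "E x a" "d x y = d a y + 1"
proof -
  from assms obtain n where n: "d x y = Suc n"
    using gdist_eq_0 by (metis not0_implies_Suc)
  then obtain a where a: "E x a" "(E ^^ n) a y"
    using walk_gdist[OF assms(1,2)] relpowp_Suc_D2 by metis
  moreover have "d x y \<le> 1 + d a y"
    using gdist_triangle[of x a y] gdist_edge[of x a] a(1) assms edge_in_V by metis
  moreover have "d a y \<le> n" using a(2) by (rule gdist_le_walk)
  ultimately show thesis using n that by simp
qed

text \<open>
  The edges bound the distance of two vertices of the path from above, and their distances from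
  the initial vertex bound it from below.
\<close>

lemma geodesic_pathI:
  assumes "\<And>i. enat i \<le> N \<Longrightarrow> p i \<in> V"
    and edge: "\<And>i. enat (Suc i) \<le> N \<Longrightarrow> E (p i) (p (Suc i))"
    and rank: "\<And>i. enat i \<le> N \<Longrightarrow> d (p 0) (p i) = i"
  shows "geodesic_path V E N p"
  unfolding geodesic_path_def
proof (intro conjI allI impI; (elim conjE)?)
  fix i j assume ij: "i \<le> j" and jN: "enat j \<le> N"
  have iN: "enat i \<le> N" using ij jN order_trans enat_ord_simps(1) by metis
  have "(E ^^ k) (p i) (p (i + k))" if "enat (i + k) \<le> N" for k
    using that
  proof (induction k)
    case (Suc k)
    then have "enat (i + k) \<le> N" by (meson enat_ord_simps(1) le_add2 add_le_mono le_SucI order_refl order_trans)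
    with Suc show ?case using edge[of "i + k"] by auto
  qed simp
  from this[of "j - i"] have "d (p i) (p j) \<le> j - i"
    using ij jN gdist_le_walk by simp
  moreover have "p 0 \<in> V" using assms(1)[of 0] by (simp add: zero_enat_def[symmetric])
  then have "j \<le> i + d (p i) (p j)"
    using gdist_triangle[of "p 0" "p i" "p j"] rank[OF iN] rank[OF jN] assms(1) iN jN by simp
  ultimately show "d (p i) (p j) = j - i" by simp
qed (use assms in auto)

lemma shortest_walk_geodesic:
  assumes "p 0 \<in> V" "\<And>i. i < m \<Longrightarrow> E (p i) (p (Suc i))" "d (p 0) (p m) = m"
  shows "geodesic_path V E (enat m) p"
proof (rule geodesic_pathI)
  have inV: "p i \<in> V" if "i \<le> m" for i
    using assms(1) edge_in_V(2)[OF assms(2)] that by (cases i) (auto simp: Suc_le_eq)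
  then show "p i \<in> V" if "enat i \<le> enat m" for i using that by simp
  show "E (p i) (p (Suc i))" if "enat (Suc i) \<le> enat m" for i using that assms(2) by simp
  fix i assume "enat i \<le> enat m"
  then have i: "i \<le> m" by simp
  have "(E ^^ i) (p 0) (p i)" unfolding relpowp_fun_conv
    using i assms(2) by (intro exI[of _ p]) auto
  then have "d (p 0) (p i) \<le> i" by (rule gdist_le_walk)
  moreover have "(E ^^ (m - i)) (p i) (p m)" unfolding relpowp_fun_conv
    using i assms(2) by (intro exI[of _ "\<lambda>k. p (i + k)"]) auto
  then have "d (p i) (p m) \<le> m - i" by (rule gdist_le_walk)
  moreover have "m \<le> d (p 0) (p i) + d (p i) (p m)"
    using gdist_triangle[of "p 0" "p i" "p m"] inV i assms(3) by simp
  ultimately show "d (p 0) (p i) = i" using i by simp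
qed

text \<open>
  For the converse direction, shortest walks from \<open>r\<close> to \<open>x\<close> and from \<open>x\<close> to \<open>y\<close> are concatenated;
  the result has length \<open>d r y\<close> and is therefore geodesic.
\<close>

lemma root_le_iff:
  assumes "r \<in> V"
  shows "root_le V E r x y \<longleftrightarrow> x \<in> V \<and> y \<in> V \<and> d r y = d r x + d x y"
proof
  assume "root_le V E r x y"
  then obtain m p i where p: "geodesic_path V E (enat m) p" "p 0 = r" "p m = y" "i \<le> m" "p i = x"
    unfolding root_le_def by blast
  have g: "d (p j) (p k) = k - j" if "j \<le> k" "k \<le> m" for j k
    using p(1) that unfolding geodesic_path_def by simp
  show "x \<in> V \<and> y \<in> V \<and> d r y = d r x + d x y"
    using p g[of 0 i] g[of i m] g[of 0 m] unfolding geodesic_path_def by auto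
next
  assume xy: "x \<in> V \<and> y \<in> V \<and> d r y = d r x + d x y"
  obtain f where f: "f 0 = r" "f (d r x) = x" "\<And>i. i < d r x \<Longrightarrow> E (f i) (f (Suc i))"
    using walk_gdist[of r x] xy assms unfolding relpowp_fun_conv by blast
  obtain g where g: "g 0 = x" "g (d x y) = y" "\<And>i. i < d x y \<Longrightarrow> E (g i) (g (Suc i))"
    using walk_gdist[of x y] xy unfolding relpowp_fun_conv by blast
  define p where "p i = (if i \<le> d r x then f i else g (i - d r x))" for i
  have g_eq: "p i = g (i - d r x)" if "d r x \<le> i" for i
    using that f(2) g(1) by (cases "i = d r x") (auto simp: p_def)
  have p0: "p 0 = r" and px: "p (d r x) = x" using f by (auto simp: p_def)
  have py: "p (d r y) = y" using g_eq[of "d r y"] g(2) xy by simp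
  have edge: "E (p i) (p (Suc i))" if "i < d r y" for i
  proof (cases "i < d r x")
    case True
    then show ?thesis using f(3)[of i] by (simp add: p_def)
  next
    case False
    then have "i - d r x < d x y" using that xy by simp
    from g(3)[OF this] False show ?thesis
      using g_eq[of i] g_eq[of "Suc i"] by (simp add: Suc_diff_le)
  qed
  have "geodesic_path V E (enat (d r y)) p"
    by (rule shortest_walk_geodesic) (use p0 py assms edge in auto)
  then show "root_le V E r x y" unfolding root_le_def
    using p0 px py xy by (metis le_add1)
qed

end

section \<open>The order of a rooted graph\<close>

locale rooted_graph = connected_simple_graph +
  fixes r :: 'a
  assumes root: "r \<in> V"
begin

abbreviation below :: "'a \<Rightarrow> 'a \<Rightarrow> bool" (infix "\<preceq>" 50) where
  "x \<preceq> y \<equiv> root_le V E r x y"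

lemmas below_iff = root_le_iff[OF root]

lemma below_in_V: "x \<preceq> y \<Longrightarrow> x \<in> V" "x \<preceq> y \<Longrightarrow> y \<in> V"
  by (auto simp: below_iff)

lemma below_refl: "x \<in> V \<Longrightarrow> x \<preceq> x"
  by (simp add: below_iff)

lemma root_below: "x \<in> V \<Longrightarrow> r \<preceq> x"
  by (simp add: below_iff root)

lemma below_trans:
  assumes "x \<preceq> y" "y \<preceq> z"
  shows "x \<preceq> z"
  using assms gdist_triangle[of x y z] gdist_triangle[of r x z] root
  unfolding below_iff by auto

lemma below_rank_eq: "x \<preceq> y \<Longrightarrow> d r y \<le> d r x \<Longrightarrow> x = y"
  using gdist_eq_0[of x y] unfolding below_iff by auto

text \<open>Below \<open>u\<close>, the covers of \<open>x\<close> are the neighbours of \<open>x\<close> that are closer to \<open>u\<close>.\<close>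

lemma closer_neighbour_below:
  assumes "x \<preceq> u" "E x a" "d x u = d a u + 1"
  shows "a \<preceq> u" "x \<preceq> a" "d r a = d r x + 1"
proof -
  have "d r a \<le> d r x + 1" "d r u \<le> d r a + d a u"
    using gdist_triangle[of r x a] gdist_triangle[of r a u] gdist_edge[of x a] assms(1,2)
      root edge_in_V unfolding below_iff by metis+
  then show *: "d r a = d r x + 1" using assms unfolding below_iff by auto
  show "a \<preceq> u" "x \<preceq> a"
    using * assms edge_in_V[OF assms(2)] gdist_edge[OF assms(2)] unfolding below_iff by auto
qed

lemma cover_below:
  assumes "x \<preceq> u" "x \<noteq> u"
  obtains a where "E x a" "x \<preceq> a" "a \<preceq> u" "d r a = d r x + 1"
  using assms step_towards[of x u] closer_neighbour_below below_in_V by metis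

lemma covered_closer:
  assumes "E x a" "d r a = d r x + 1" "a \<preceq> u"
  shows "x \<preceq> u" "d x u = d a u + 1"
proof -
  have "x \<preceq> a" using assms gdist_edge edge_in_V unfolding below_iff by metis
  then show "x \<preceq> u" using assms(3) below_trans by blast
  then show "d x u = d a u + 1" using assms unfolding below_iff by auto
qed

section \<open>Countable directed down-sets come from geodesics\<close>

definition directed_downset :: "'a set \<Rightarrow> bool" where
  "directed_downset A \<longleftrightarrow> r \<in> A \<and> (\<forall>y\<in>A. \<forall>x. x \<preceq> y \<longrightarrow> x \<in> A) \<and>
     (\<forall>x\<in>A. \<forall>y\<in>A. \<exists>z\<in>A. x \<preceq> z \<and> y \<preceq> z)"

lemma cofinal_chain:
  assumes A: "directed_downset A" "countable A" and nomax: "\<forall>x\<in>A. \<exists>y\<in>A. \<not> y \<preceq> x"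
  shows "\<exists>c. (\<forall>n::nat. c n \<in> A) \<and> (\<forall>m n. m \<le> n \<longrightarrow> c m \<preceq> c n) \<and>
    (\<forall>n. n \<le> d r (c n)) \<and> (\<forall>x\<in>A. \<exists>n. x \<preceq> c n)"
proof -
  have dir: "\<And>x y. x \<in> A \<Longrightarrow> y \<in> A \<Longrightarrow> \<exists>z\<in>A. x \<preceq> z \<and> y \<preceq> z" and "r \<in> A"
    using A(1) unfolding directed_downset_def by blast+
  define a where "a = from_nat_into A"
  have range_a: "range a = A"
    unfolding a_def using \<open>r \<in> A\<close> A(2) by (intro range_from_nat_into) auto
  have "\<exists>c. \<forall>n. c n \<in> A \<and> (c n \<preceq> c (Suc n) \<and> c n \<noteq> c (Suc n) \<and> a n \<preceq> c (Suc n))"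
  proof (rule dependent_nat_choice)
    show "\<exists>x. x \<in> A" using \<open>r \<in> A\<close> by blast
    fix x n assume x: "x \<in> A"
    obtain y where y: "y \<in> A" "\<not> y \<preceq> x" using nomax x by blast
    obtain z where z: "z \<in> A" "x \<preceq> z" "y \<preceq> z" using dir x y by blast
    moreover obtain w where "w \<in> A" "z \<preceq> w" "a n \<preceq> w" using dir z range_a by blast
    moreover have "x \<noteq> w" using y z \<open>z \<preceq> w\<close> below_trans by blast
    ultimately show "\<exists>w. w \<in> A \<and> x \<preceq> w \<and> x \<noteq> w \<and> a n \<preceq> w" using below_trans by blast
  qed
  then obtain c where c: "\<And>n. c n \<in> A" "\<And>n. c n \<preceq> c (Suc n)"
      "\<And>n. c n \<noteq> c (Suc n)" "\<And>n. a n \<preceq> c (Suc n)" by blast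
  show ?thesis
  proof (intro exI[of _ c] conjI allI impI ballI)
    show "c m \<preceq> c n" if "m \<le> n" for m n
      using that by (induction rule: dec_induct) (use c below_refl below_in_V below_trans in blast)+
    show "n \<le> d r (c n)" for n
    proof (induction n)
      case (Suc n)
      have "d r (c n) < d r (c (Suc n))" using c(2,3) below_rank_eq by (meson not_less)
      with Suc show ?case by simp
    qed simp
    show "\<exists>n. x \<preceq> c n" if "x \<in> A" for x using that c(4) range_a by blast
  qed (use c in auto)
qed

text \<open>
  The ray is built one edge at a time, so that its \<open>n\<close>-th vertex has rank \<open>n\<close>. At time \<open>n\<close> it
  moves towards the first member of a cofinal chain with rank exceeding \<open>n\<close>. Keeping this aim
  until its rank is attained forces the ray to pass through every member of the chain.
\<close>

lemma directed_imp_ascending_ray: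
  assumes A: "directed_downset A" "countable A" and nomax: "\<forall>x\<in>A. \<exists>y\<in>A. \<not> y \<preceq> x"
  shows "\<exists>p. geodesic_path V E \<infinity> p \<and> p 0 = r \<and> (\<forall>n. p n \<in> A) \<and> (\<forall>x\<in>A. \<exists>n. x \<preceq> p n)"
proof -
  obtain c where "\<forall>n. c n \<in> A" "\<forall>m n. m \<le> n \<longrightarrow> c m \<preceq> c n"
      "\<forall>n. n \<le> d r (c n)" "\<forall>x\<in>A. \<exists>n. x \<preceq> c n"
    using cofinal_chain[OF assms] by (elim exE conjE)
  note c = this[rule_format]
  define k where "k n = (LEAST j. n < d r (c j))" for n
  have k: "n < d r (c (k n))" for n
    unfolding k_def
    by (rule LeastI[of "\<lambda>j. n < d r (c j)" "Suc n"]) (use c(3)[of "Suc n"] in simp)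
  have k_le: "k n \<le> j" if "n < d r (c j)" for n j
    unfolding k_def using that by (rule Least_le)
  have "\<exists>p. \<forall>n. (d r (p n) = n \<and> p n \<preceq> c (k n)) \<and> (E (p n) (p (Suc n)) \<and> p (Suc n) \<preceq> c (k n))"
  proof (rule dependent_nat_choice)
    show "\<exists>x. d r x = 0 \<and> x \<preceq> c (k 0)"
      using root_below c(1,2) below_in_V by (intro exI[of _ r]) (metis gdist_self order_refl)
    fix x n assume x: "d r x = n \<and> x \<preceq> c (k n)"
    then have "x \<noteq> c (k n)" using k[of n] by auto
    then obtain y where y: "E x y" "y \<preceq> c (k n)" "d r y = Suc n"
      using x cover_below by (metis Suc_eq_plus1)
    have "k n \<le> k (Suc n)" using k[of "Suc n"] by (intro k_le) simp
    then have "y \<preceq> c (k (Suc n))" using y c(2) below_trans by blast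
    then show "\<exists>y. (d r y = Suc n \<and> y \<preceq> c (k (Suc n))) \<and> E x y \<and> y \<preceq> c (k n)" using y by blast
  qed
  then obtain p where p: "\<And>n. d r (p n) = n" "\<And>n. p n \<preceq> c (k n)"
      "\<And>n. E (p n) (p (Suc n))" "\<And>n. p (Suc n) \<preceq> c (k n)" by blast
  have p0: "p 0 = r" using p(1,2) gdist_eq_0 root below_in_V by metis
  have through: "p (d r (c j)) = c j" for j
  proof (cases "d r (c j)")
    case 0
    then show ?thesis using p0 gdist_eq_0 root c(2) below_in_V by (metis order_refl)
  next
    case (Suc n)
    then have "c (k n) \<preceq> c j" using k_le c(2) by simp
    then have "p (Suc n) \<preceq> c j" using p(4) below_trans by blast
    then have "p (Suc n) = c j" using below_rank_eq p(1) Suc by simp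
    then show ?thesis using Suc by simp
  qed
  show ?thesis
  proof (intro exI[of _ p] conjI allI ballI)
    show "geodesic_path V E \<infinity> p"
      by (rule geodesic_pathI) (use p p0 edge_in_V(1)[OF p(3)] in auto)
    show "p n \<in> A" for n
      using p(2) c(1) A(1) unfolding directed_downset_def by blast
    show "\<exists>n. x \<preceq> p n" if "x \<in> A" for x using c(4)[OF that] through by metis
  qed (fact p0)
qed

lemma directed_imp_path_sequence:
  assumes A: "directed_downset A" "countable A"
  shows "\<exists>N p. geodesic_path V E N p \<and> range (path_sequence N p) \<subseteq> V \<and>
    (\<forall>x\<in>A. root_le_seq V E r x (path_sequence N p)) \<and>
    (\<forall>x n. x \<preceq> path_sequence N p n \<longrightarrow> x \<in> A)"
proof -
  have down: "\<And>x y. y \<in> A \<Longrightarrow> x \<preceq> y \<Longrightarrow> x \<in> A"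
    and dir: "\<And>x y. x \<in> A \<Longrightarrow> y \<in> A \<Longrightarrow> \<exists>z\<in>A. x \<preceq> z \<and> y \<preceq> z"
    using A(1) unfolding directed_downset_def by blast+
  have AV: "A \<subseteq> V" using dir below_in_V by blast
  show ?thesis
  proof (cases "\<exists>m\<in>A. \<forall>x\<in>A. x \<preceq> m")
    case True
    then obtain m where m: "m \<in> A" "\<And>x. x \<in> A \<Longrightarrow> x \<preceq> m" by blast
    obtain n p where p: "geodesic_path V E (enat n) p" "p 0 = r" "p n = m"
      using root_below[of m] m AV unfolding root_le_def by blast
    have vertex: "path_sequence (enat n) p i \<preceq> m" for i
    proof -
      have "p (min i n) \<preceq> p n" unfolding root_le_def using p(1,2) by (metis min.cobounded2)
      then show ?thesis using p(3) by (simp add: path_sequence_def)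
    qed
    show ?thesis
    proof (intro exI[of _ "enat n"] exI[of _ p] conjI ballI allI impI)
      show "root_le_seq V E r x (path_sequence (enat n) p)" if "x \<in> A" for x
        unfolding root_le_seq_def
        by (rule eventually_sequentiallyI[of n]) (use m p that in \<open>auto simp: path_sequence_def\<close>)
      show "x \<in> A" if "x \<preceq> path_sequence (enat n) p i" for x i
        using that vertex below_trans down m(1) by blast
      show "range (path_sequence (enat n) p) \<subseteq> V" using vertex below_in_V by blast
      show "geodesic_path V E (enat n) p" by (rule p(1))
    qed
  next
    case False
    then have nomax: "\<forall>x\<in>A. \<exists>y\<in>A. \<not> y \<preceq> x" by blast
    obtain p where "geodesic_path V E \<infinity> p" "p 0 = r" "\<forall>n. p n \<in> A" "\<forall>x\<in>A. \<exists>n. x \<preceq> p n"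
      using directed_imp_ascending_ray[OF A nomax] by (elim exE conjE)
    note p = this[rule_format]
    have seq: "path_sequence \<infinity> p = p" by (auto simp: path_sequence_def)
    have mono: "p i \<preceq> p j" if "i \<le> j" for i j
      unfolding root_le_def using p(1,2) that
      by (intro exI[of _ j] exI[of _ p]) (auto simp: geodesic_path_def)
    show ?thesis
    proof (intro exI[of _ \<infinity>] exI[of _ p] conjI ballI allI impI, unfold seq)
      show "root_le_seq V E r x p" if x: "x \<in> A" for x
      proof -
        obtain n where "x \<preceq> p n" using p(4) x by blast
        then show ?thesis unfolding root_le_seq_def
          by (intro eventually_sequentiallyI[of n]) (use mono below_trans in blast)
      qed
      show "x \<in> A" if "x \<preceq> p i" for x i using that down p(3) by blast
      show "range p \<subseteq> V" using p(3) AV by blast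
      show "geodesic_path V E \<infinity> p" by (rule p(1))
    qed
  qed
qed

end

section \<open>Joins in quasi-median graphs\<close>

locale rooted_quasi_median_graph = rooted_graph +
  assumes quasi_median: "quasi_median V E"
begin

lemma triangles_sharing_edge:
  assumes "E a b" "E x a" "E x b" "E z a" "E z b" "x \<noteq> z"
  shows "E x z"
proof (rule ccontr)
  assume "\<not> E x z"
  then have "\<not> E z x" using edge_sym by blast
  define f where "f = (\<lambda>n::nat. if n = 0 then a else if n = 1 then b else if n = 2 then x else z)"
  have "a \<noteq> b" "x \<noteq> a" "x \<noteq> b" "z \<noteq> a" "z \<noteq> b" using assms edge_irrefl by auto
  then have "inj_on f {0, 1, 2, 3}" using assms(6) by (simp add: f_def inj_on_def)
  moreover have "f ` {0, 1, 2, 3} \<subseteq> V" using assms edge_in_V by (simp add: f_def)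
  moreover have "\<forall>u\<in>{0, 1, 2, 3}. \<forall>v\<in>{0, 1, 2, 3}. E (f u) (f v) \<longleftrightarrow> K4_minus_adj u v"
    using assms assms(1-5)[THEN edge_sym] \<open>\<not> E x z\<close> \<open>\<not> E z x\<close> edge_irrefl
    by (simp add: f_def K4_minus_adj_def doubleton_eq_iff)
  ultimately have "has_induced_copy V E {0, 1, 2, 3} K4_minus_adj"
    unfolding has_induced_copy_def by blast
  then show False using quasi_median unfolding quasi_median_def by blast
qed

lemma no_K32:
  assumes "E x a" "E y a" "E z a" "E x b" "E y b" "E z b"
    and "a \<noteq> b" "x \<noteq> y" "x \<noteq> z" "y \<noteq> z" "\<not> E a b" "\<not> E x y" "\<not> E x z" "\<not> E y z"
  shows False
proof -
  define f where "f = (\<lambda>n::nat. if n = 0 then x else if n = 1 then y else if n = 2 then z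
    else if n = 3 then a else b)"
  have "x \<noteq> a" "y \<noteq> a" "z \<noteq> a" "x \<noteq> b" "y \<noteq> b" "z \<noteq> b" using assms edge_irrefl by auto
  then have "inj_on f {0, 1, 2, 3, 4}" using assms(7-10) by (simp add: f_def inj_on_def)
  moreover have "f ` {0, 1, 2, 3, 4} \<subseteq> V" using assms(1-6) edge_in_V by (simp add: f_def)
  moreover have "\<not> E b a" "\<not> E y x" "\<not> E z x" "\<not> E z y" using assms(11-14) edge_sym by blast+
  then have "\<forall>u\<in>{0, 1, 2, 3, 4}. \<forall>v\<in>{0, 1, 2, 3, 4}. E (f u) (f v) \<longleftrightarrow> K32_adj u v"
    using assms assms(1-6)[THEN edge_sym] edge_irrefl by (simp add: f_def K32_adj_def)
  ultimately have "has_induced_copy V E {0, 1, 2, 3, 4} K32_adj"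
    unfolding has_induced_copy_def by blast
  then show False using quasi_median unfolding quasi_median_def by blast
qed

text \<open>
  Two covers \<open>a\<close>, \<open>b\<close> of \<open>x\<close> below \<open>u\<close> cannot be adjacent: the triangle condition based at \<open>u\<close> would
  provide a second triangle on the edge \<open>a b\<close>, whose apex is two ranks above \<open>x\<close>. So the quadrangle
  condition based at \<open>u\<close> applies.
\<close>

lemma common_cover_below:
  assumes a: "E x a" "d r a = d r x + 1" "a \<preceq> u" and b: "E x b" "d r b = d r x + 1" "b \<preceq> u"
    and "a \<noteq> b"
  obtains w where "E a w" "E b w" "d r w = d r x + 2" "w \<preceq> u" "\<not> E a b"
proof -
  note V = edge_in_V[OF a(1)] edge_in_V[OF b(1)] below_in_V(2)[OF a(3)]
  note xa = covered_closer[OF a] and xb = covered_closer[OF b]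
  have sym: "d u a = d a u" "d u b = d b u" "d u x = d x u" using V gdist_sym by blast+
  have apart: "\<not> E a b"
  proof
    assume "E a b"
    then obtain z where z: "z \<in> V" "E a z" "E b z" "d u z + 1 = d u a"
      using quasi_median V xa xb sym unfolding quasi_median_def triangle_condition_def
      by (metis add_right_cancel)
    have "d a u = d z u + 1" using z sym V gdist_sym by metis
    note rank = closer_neighbour_below[OF a(3) z(2) this]
    have "x \<noteq> z" using rank a(2) by auto
    then have "E x z" using triangles_sharing_edge \<open>E a b\<close> a(1) b(1) z edge_sym by blast
    then have "d r z \<le> d r x + 1"
      using gdist_triangle[of r x z] gdist_edge[of x z] root V z(1) by simp
    then show False using rank a(2) by simp
  qed
  have "gdist E a x = 1" "gdist E b x = 1" using a b gdist_edge edge_sym by blast+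
  then obtain w where w: "w \<in> V" "E a w" "E b w" "d u w + 2 = d u x"
    using quasi_median V xa xb sym \<open>a \<noteq> b\<close> apart
    unfolding quasi_median_def quadrangle_condition_def by (metis add_right_cancel)
  have "d a u = d w u + 1" using w sym V gdist_sym xa by (metis add_2_eq_Suc' Suc_eq_plus1 Suc_inject)
  from closer_neighbour_below[OF a(3) w(2) this] a(2) show thesis
    by (intro that[OF w(2,3) _ _ apart]) auto
qed

text \<open>
  Two common covers of \<open>a\<close> and \<open>b\<close> would span, together with \<open>x\<close>, \<open>a\<close> and \<open>b\<close>, an induced \<open>K\<^sub>3\<^sub>,\<^sub>2\<close>, or
  together with \<open>a\<close> and \<open>b\<close> an induced \<open>K\<^sub>4\<close> minus an edge.
\<close>

lemma common_cover_unique: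
  assumes "E x a" "E x b" "a \<noteq> b" "\<not> E a b"
    and v: "E a v" "E b v" "d r v = d r x + 2" and w: "E a w" "E b w" "d r w = d r x + 2"
  shows "v = w"
proof (rule ccontr)
  assume "v \<noteq> w"
  have far: "\<not> E x y" "x \<noteq> y" if "d r y = d r x + 2" for y
    using gdist_triangle[of r x y] gdist_edge[of x y] root edge_in_V[of x y] that by auto
  have "\<not> E v w"
    using triangles_sharing_edge[of v w a b] v w assms by blast
  then show False
    using no_K32[of x a v w b] assms far(1)[OF v(3)] far(1)[OF w(3)] far(2)[OF v(3)] far(2)[OF w(3)]
      \<open>v \<noteq> w\<close> edge_sym by blast
qed

lemma local_join:
  assumes "E x a" "d r a = d r x + 1" "E x b" "d r b = d r x + 1" "a \<noteq> b"
    and "a \<preceq> u" "b \<preceq> u" "a \<preceq> v" "b \<preceq> v"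
  obtains w where "a \<preceq> w" "b \<preceq> w" "w \<preceq> u" "w \<preceq> v"
proof -
  obtain w where w: "E a w" "E b w" "d r w = d r x + 2" "w \<preceq> u" "\<not> E a b"
    using common_cover_below assms by metis
  obtain w' where w': "E a w'" "E b w'" "d r w' = d r x + 2" "w' \<preceq> v"
    using common_cover_below assms by metis
  have "w = w'" using common_cover_unique[of x a b w w'] w w' assms by blast
  moreover have "a \<preceq> w" "b \<preceq> w"
    using w assms edge_in_V gdist_edge unfolding below_iff by fastforce+
  ultimately show thesis using that w w' by blast
qed

text \<open>
  The induction is on the distance from a common lower bound \<open>q\<close> of \<open>x\<close> and \<open>y\<close> to \<open>u\<close>. With covers
  \<open>a\<close>, \<open>b\<close> of \<open>q\<close> below \<open>x\<close> and \<open>y\<close> and their local join \<open>c\<close>, one first interpolates for \<open>x\<close> and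
  \<open>c\<close>, which are above \<open>a\<close>, and then for \<open>y\<close> and the result, which are above \<open>b\<close>.
\<close>

lemma interpolation_above:
  assumes "q \<preceq> x" "q \<preceq> y" "x \<preceq> u" "y \<preceq> u" "x \<preceq> v" "y \<preceq> v"
  shows "\<exists>z. x \<preceq> z \<and> y \<preceq> z \<and> z \<preceq> u \<and> z \<preceq> v"
  using assms
proof (induction "d q u" arbitrary: q x y rule: less_induct)
  case less
  show ?case
  proof (cases "q = x \<or> q = y")
    case True
    then show ?thesis using less.prems below_refl below_in_V by blast
  next
    case False
    obtain a where a: "E q a" "a \<preceq> x" "d r a = d r q + 1"
      using cover_below less.prems(1) False by metis
    obtain b where b: "E q b" "b \<preceq> y" "d r b = d r q + 1"
      using cover_below less.prems(2) False by metis
    have au: "a \<preceq> u" "a \<preceq> v" and bu: "b \<preceq> u" "b \<preceq> v"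
      using a b less.prems below_trans by blast+
    have da: "d a u < d q u" using covered_closer(2)[OF a(1,3) au(1)] by simp
    have db: "d b u < d q u" using covered_closer(2)[OF b(1,3) bu(1)] by simp
    show ?thesis
    proof (cases "a = b")
      case True
      then show ?thesis using less.hyps[OF da] a b less.prems by blast
    next
      case False
      then obtain c where c: "a \<preceq> c" "b \<preceq> c" "c \<preceq> u" "c \<preceq> v"
        using local_join[of q a b u v] a b au bu by blast
      obtain z where z: "x \<preceq> z" "c \<preceq> z" "z \<preceq> u" "z \<preceq> v"
        using less.hyps[OF da a(2) c(1)] c less.prems by blast
      have "b \<preceq> z" using c z below_trans by blast
      then obtain z' where "y \<preceq> z'" "z \<preceq> z'" "z' \<preceq> u" "z' \<preceq> v"
        using less.hyps[OF db b(2)] z less.prems by blast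
      then show ?thesis using z below_trans by blast
    qed
  qed
qed

lemma interpolation:
  assumes "x \<preceq> u" "y \<preceq> u" "x \<preceq> v" "y \<preceq> v"
  obtains z where "x \<preceq> z" "y \<preceq> z" "z \<preceq> u" "z \<preceq> v"
  using interpolation_above[of r x y u v] assms root_below below_in_V by blast

text \<open>By interpolation, an upper bound of minimal rank is below every other one.\<close>

lemma join_exists:
  assumes "x \<preceq> u" "y \<preceq> u"
  shows "\<exists>z. x \<preceq> z \<and> y \<preceq> z \<and> (\<forall>v. x \<preceq> v \<and> y \<preceq> v \<longrightarrow> z \<preceq> v)"
proof -
  obtain z where z: "x \<preceq> z" "y \<preceq> z" "\<And>v. x \<preceq> v \<Longrightarrow> y \<preceq> v \<Longrightarrow> d r z \<le> d r v"
    using ex_has_least_nat[of "\<lambda>z. x \<preceq> z \<and> y \<preceq> z" u "d r"] assms by blast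
  have "z \<preceq> v" if v: "x \<preceq> v" "y \<preceq> v" for v
  proof -
    obtain w where w: "x \<preceq> w" "y \<preceq> w" "w \<preceq> z" "w \<preceq> v"
      using interpolation[of x z y v] z v by metis
    then have "w = z" using below_rank_eq z(3) by blast
    then show ?thesis using w by blast
  qed
  then show ?thesis using z by blast
qed

section \<open>The compactification\<close>

lemma directed_downset_root_le_seq:
  assumes s: "s \<in> root_converging V E r"
  shows "directed_downset {x. root_le_seq V E r x s}"
proof -
  have sV: "s n \<in> V" for n using s unfolding root_converging_def by blast
  have "root_le_seq V E r r s" unfolding root_le_seq_def using root_below sV by simp
  moreover have "root_le_seq V E r x s" if "root_le_seq V E r y s" "x \<preceq> y" for x y
    using that unfolding root_le_seq_def
    by (auto elim: eventually_mono intro: below_trans)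
  moreover have "\<exists>z. root_le_seq V E r z s \<and> x \<preceq> z \<and> y \<preceq> z"
    if "root_le_seq V E r x s" "root_le_seq V E r y s" for x y
  proof -
    have both: "\<forall>\<^sub>F n in sequentially. x \<preceq> s n \<and> y \<preceq> s n"
      using that unfolding root_le_seq_def by (rule eventually_conj)
    then obtain n where "x \<preceq> s n" "y \<preceq> s n"
      unfolding eventually_sequentially by blast
    then obtain z where z: "x \<preceq> z" "y \<preceq> z" "\<forall>v. x \<preceq> v \<and> y \<preceq> v \<longrightarrow> z \<preceq> v"
      using join_exists by blast
    have "root_le_seq V E r z s" unfolding root_le_seq_def
      using both by (rule eventually_mono) (use z in blast)
    then show ?thesis using z by blast
  qed
  ultimately show ?thesis unfolding directed_downset_def by blast
qed

text \<open>
  A geodesic with the same eventual lower bounds as \<open>s\<close> represents the class of \<open>s\<close>. It converges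
  because a vertex outside \<open>A\<close> is below none of its vertices.
\<close>

lemma visual_of_countable:
  assumes "countable V"
  shows "visual V E r"
  unfolding visual_def graph_compactification_def
proof
  fix C assume "C \<in> root_converging V E r // root_equiv V E r"
  then obtain s where s: "s \<in> root_converging V E r" and C: "C = root_equiv V E r `` {s}"
    by (elim quotientE)
  define A where "A = {x. root_le_seq V E r x s}"
  have "x \<in> V" if "x \<in> A" for x
  proof -
    obtain n where "x \<preceq> s n"
      using \<open>x \<in> A\<close> eventually_happens unfolding A_def root_le_seq_def by force
    then show ?thesis by (rule below_in_V)
  qed
  then have "A \<subseteq> V" by (rule subsetI)
  then have "countable A" using assms by (rule countable_subset)
  moreover have "directed_downset A" unfolding A_def using s by (rule directed_downset_root_le_seq)
  ultimately have "\<exists>N p. geodesic_path V E N p \<and> range (path_sequence N p) \<subseteq> V \<and>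
      (\<forall>x\<in>A. root_le_seq V E r x (path_sequence N p)) \<and>
      (\<forall>x n. x \<preceq> path_sequence N p n \<longrightarrow> x \<in> A)"
    by (intro directed_imp_path_sequence)
  then obtain N p where p: "geodesic_path V E N p" "range (path_sequence N p) \<subseteq> V"
      and le: "\<forall>x\<in>A. root_le_seq V E r x (path_sequence N p)"
      and A_if: "\<forall>x n. x \<preceq> path_sequence N p n \<longrightarrow> x \<in> A"
    by (elim exE conjE)
  have nle: "root_nle_seq V E r x (path_sequence N p)"
    and not_le: "\<not> root_le_seq V E r x (path_sequence N p)" if "x \<notin> A" for x
    using that A_if unfolding root_nle_seq_def root_le_seq_def by (auto simp: eventually_sequentially)
  have "path_sequence N p \<in> root_converging V E r"
    unfolding root_converging_def using p(2) le nle by blast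
  moreover have "root_le_seq V E r x s \<longleftrightarrow> root_le_seq V E r x (path_sequence N p)" for x
    using le not_le unfolding A_def by blast
  ultimately have "path_sequence N p \<in> C" unfolding C root_equiv_def using s by blast
  then show "\<exists>N p. geodesic_path V E N p \<and> path_sequence N p \<in> C" using p(1) by blast
qed

end

theorem lemma4p32:
  fixes V :: "'a set" and E :: "'a \<Rightarrow> 'a \<Rightarrow> bool"
  assumes "simple_graph V E"
    and "countable V"
    and "connected_graph V E"
    and "quasi_median V E"
  shows "\<forall>r\<in>V. visual V E r"
proof
  fix r assume "r \<in> V"
  then interpret rooted_quasi_median_graph V E r
    using assms by unfold_locales
  show "visual V E r" using assms(2) by (rule visual_of_countable)
qed

end
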